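(* Let $(S,\{\to_e,\to_{\neg e}\})$ be an essential system, with $\to\;=\;\to_e\cup\to_{\neg e}$. If $t\to^* u$ and $u$ is $\to_e$-normal, then $t$ is strongly $\to_e$-normalizing.
   Context: A rewriting system is a pair $(S,\to)$ with $S$ a set and $\to\subseteq S\times S$. We write $(S,\{\to_e,\to_{\neg e}\})$ for the rewriting system $(S,\to)$ with $\to\;=\;\to_e\cup\to_{\neg e}$ (not necessarily disjoint). $\to^*$ is the reflexive-transitive closure; $t\to_a\cdot\to_b s$ means $t\to_a u\to_b s$ for some $u$. A term $t$ is $\to$-normal if there is no $s$ with $t\to s$; weakly $\to$-normalizing if $t\to^* s$ for some $\to$-normal $s$; strongly $\to$-normalizing if there is no infinite $\to$-sequence from $t$. The system is essential if: (1) Persistence: if $t\to_e s$ and $t\to_{\neg e}u$ then $u\to_e r$ for some $r$; (2) Uniform termination: every weakly $\to_e$-normalizing term is strongly $\to_e$-normalizing; (3) Terminal factorization: if $t\to^* u$ and $u$ is $\to_e$-normal then $t\to_e^*\cdot\to_{\neg e}^* u$. *)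

theory Defs
  imports Main
begin

definition rewriting_system :: "'a set \<Rightarrow> 'a rel \<Rightarrow> bool" where
  "rewriting_system S r \<longleftrightarrow> r \<subseteq> S \<times> S"

definition normal :: "'a rel \<Rightarrow> 'a \<Rightarrow> bool" where
  "normal r t \<longleftrightarrow> \<not> (\<exists>s. (t, s) \<in> r)"

definition weakly_normalizing :: "'a rel \<Rightarrow> 'a \<Rightarrow> bool" where
  "weakly_normalizing r t \<longleftrightarrow> (\<exists>s. (t, s) \<in> r\<^sup>* \<and> normal r s)"

definition strongly_normalizing :: "'a rel \<Rightarrow> 'a \<Rightarrow> bool" where
  "strongly_normalizing r t \<longleftrightarrow>
     \<not> (\<exists>f :: nat \<Rightarrow> 'a. f 0 = t \<and> (\<forall>i. (f i, f (Suc i)) \<in> r))"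

definition persistence :: "'a set \<Rightarrow> 'a rel \<Rightarrow> 'a rel \<Rightarrow> bool" where
  "persistence S e ne \<longleftrightarrow>
     (\<forall>t\<in>S. \<forall>s\<in>S. \<forall>u\<in>S. (t, s) \<in> e \<longrightarrow> (t, u) \<in> ne \<longrightarrow> (\<exists>r\<in>S. (u, r) \<in> e))"

definition uniform_termination :: "'a set \<Rightarrow> 'a rel \<Rightarrow> bool" where
  "uniform_termination S e \<longleftrightarrow>
     (\<forall>t\<in>S. weakly_normalizing e t \<longrightarrow> strongly_normalizing e t)"

definition terminal_factorization :: "'a set \<Rightarrow> 'a rel \<Rightarrow> 'a rel \<Rightarrow> bool" where
  "terminal_factorization S e ne \<longleftrightarrow>
     (\<forall>t\<in>S. \<forall>u\<in>S. (t, u) \<in> (e \<union> ne)\<^sup>* \<longrightarrow> normal e u \<longrightarrow> (t, u) \<in> e\<^sup>* O ne\<^sup>*)"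

definition essential_system :: "'a set \<Rightarrow> 'a rel \<Rightarrow> 'a rel \<Rightarrow> bool" where
  "essential_system S e ne \<longleftrightarrow>
     rewriting_system S (e \<union> ne) \<and>
     persistence S e ne \<and> uniform_termination S e \<and> terminal_factorization S e ne"

end

theory Submission
  imports Defs
begin

text \<open>Terminal factorization splits the reduction: \<open>t\<close> reaches some
  \<open>s\<close> by \<open>e\<close>-steps, and \<open>s\<close> reaches \<open>u\<close> by
  \<open>ne\<close>-steps. By persistence an \<open>ne\<close>-step never destroys the possibility
  of an \<open>e\<close>-step; contrapositively, \<open>e\<close>-normality travels backwards along
  \<open>ne\<close>-steps, here from \<open>u\<close> to \<open>s\<close>. So \<open>t\<close> has
  an \<open>e\<close>-normal form, and uniform termination turns this into strong
  normalization.\<close>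

lemma normal_backward_persistence:
  assumes "rewriting_system S (e \<union> ne)" and "persistence S e ne"
    and "(s, u) \<in> ne\<^sup>*" and "normal e u"
  shows "normal e s"
  using assms(3,4)
proof (induction rule: converse_rtrancl_induct)
  case base
  then show ?case .
next
  case (step s v)
  have "normal e v"
    using step.IH step.prems by blast
  show ?case
    unfolding normal_def
  proof
    assume "\<exists>r. (s, r) \<in> e"
    then obtain r where r: "(s, r) \<in> e" by blast
    \<comment> \<open>Persistence speaks only of elements of \<open>S\<close>. The two steps out of
      \<open>s\<close> place \<open>s\<close>, \<open>r\<close> and \<open>v\<close> there, as both
      relations lie within \<open>S \<times> S\<close>.\<close>
    then have "s \<in> S" "r \<in> S" "v \<in> S"
      using assms(1) \<open>(s, v) \<in> ne\<close> by (auto simp: rewriting_system_def)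
    then have "\<exists>w. (v, w) \<in> e"
      using assms(2) r \<open>(s, v) \<in> ne\<close> unfolding persistence_def by blast
    with \<open>normal e v\<close> show False
      by (simp add: normal_def)
  qed
qed

theorem theorem2:
  fixes S :: "'a set" and e ne :: "'a rel" and t u :: 'a
  assumes "essential_system S e ne"
    and "t \<in> S" and "u \<in> S"
    and "(t, u) \<in> (e \<union> ne)\<^sup>*"
    and "normal e u"
  shows "strongly_normalizing e t"
proof -
  have sys: "rewriting_system S (e \<union> ne)" "persistence S e ne"
    and ut: "uniform_termination S e" and tf: "terminal_factorization S e ne"
    using assms(1) by (auto simp: essential_system_def)
  obtain s where s: "(t, s) \<in> e\<^sup>*" "(s, u) \<in> ne\<^sup>*"
    using tf assms(2-5) unfolding terminal_factorization_def by blast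
  have "normal e s"
    using normal_backward_persistence[OF sys s(2) assms(5)] .
  \<comment> \<open>The witness is the midpoint \<open>s\<close>; \<open>u\<close> itself need not
    be reachable from \<open>t\<close> by \<open>e\<close>-steps alone.\<close>
  then have "weakly_normalizing e t"
    using s(1) unfolding weakly_normalizing_def by blast
  then show ?thesis
    using ut assms(2) unfolding uniform_termination_def by blast
qed

end
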